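(* Let $R$ be an Artinian commutative ring with unity. The total zero-divisor graph $\mathrm{ZT}(R)$ is connected if and only if $P\cap \mathrm{Ann}(P)\neq\{0\}$ for all maximal associated prime ideals $P\in \mathrm{Ass}(R)$.
   Context: For a commutative ring $R$ with unity, $Z(R)$ denotes the set of zero-divisors of $R$, with $0\in Z(R)$. The total zero-divisor graph $\mathrm{ZT}(R)$ is the simple graph whose vertex set is the set of all nonzero zero-divisors of $R$ and in which distinct vertices $u,v$ are adjacent if and only if $uv=0$ and $u+v\in Z(R)$. For $S\subseteq R$, $\mathrm{Ann}(S)=\{r\in R: rs=0 \text{ for all } s\in S\}$. An associated prime of $R$ is a prime ideal of the form $P=\mathrm{Ann}(a)$ for some $a\in R$; the set of these is $\mathrm{Ass}(R)$. A maximal associated prime is an element of $\mathrm{Ass}(R)$ that is maximal with respect to inclusion among all associated primes of $R$. *)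

theory Defs
  imports "HOL-Algebra.Ideal" "Graph_Theory.Digraph_Component"
begin

locale artinian_cring = cring R for R (structure) +
  assumes descending_chain:
    "\<lbrakk>\<And>n::nat. ideal (I n) R; \<And>n. I (Suc n) \<subseteq> I n\<rbrakk> \<Longrightarrow> \<exists>m. \<forall>n\<ge>m. I n = I m"

text \<open>For a nonzero ring, \<open>\<zero>\<close> is a zero-divisor by this definition.\<close>

definition zero_divisors :: "('a, 'b) ring_scheme \<Rightarrow> 'a set" where
  "zero_divisors R =
     {x \<in> carrier R. \<exists>y \<in> carrier R. y \<noteq> \<zero>\<^bsub>R\<^esub> \<and> x \<otimes>\<^bsub>R\<^esub> y = \<zero>\<^bsub>R\<^esub>}"

text \<open>
  The simple graph is encoded as a symmetric, loop-free digraph without parallel arcs: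
  an edge between \<open>u\<close> and \<open>v\<close> is the pair of arcs \<open>(u, v)\<close>, \<open>(v, u)\<close>.
  Connectedness in Graph_Theory excludes the null graph, which is the graph of an integral
  domain.
\<close>

definition total_zero_divisor_graph :: "('a, 'b) ring_scheme \<Rightarrow> 'a pair_pre_digraph" where
  "total_zero_divisor_graph R =
     \<lparr> pverts = zero_divisors R - {\<zero>\<^bsub>R\<^esub>},
       parcs = {(u, v). u \<in> zero_divisors R - {\<zero>\<^bsub>R\<^esub>} \<and> v \<in> zero_divisors R - {\<zero>\<^bsub>R\<^esub>} \<and>
                  u \<noteq> v \<and> u \<otimes>\<^bsub>R\<^esub> v = \<zero>\<^bsub>R\<^esub> \<and> u \<oplus>\<^bsub>R\<^esub> v \<in> zero_divisors R} \<rparr>"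

definition annihilator :: "('a, 'b) ring_scheme \<Rightarrow> 'a set \<Rightarrow> 'a set" where
  "annihilator R S = {r \<in> carrier R. \<forall>s \<in> S. r \<otimes>\<^bsub>R\<^esub> s = \<zero>\<^bsub>R\<^esub>}"

definition associated_primes :: "('a, 'b) ring_scheme \<Rightarrow> 'a set set" where
  "associated_primes R =
     {P. primeideal P R \<and> (\<exists>a \<in> carrier R. P = annihilator R {a})}"

definition maximal_associated_primes :: "('a, 'b) ring_scheme \<Rightarrow> 'a set set" where
  "maximal_associated_primes R =
     {P \<in> associated_primes R. \<forall>Q \<in> associated_primes R. P \<subseteq> Q \<longrightarrow> Q = P}"

lemma (in cring) zero_in_zero_divisors:
  assumes "\<one> \<noteq> \<zero>"
  shows "\<zero> \<in> zero_divisors R"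
  using assms unfolding zero_divisors_def by (auto intro!: bexI[of _ \<one>])

lemma (in cring) total_zero_divisor_graph_bidirected:
  "pair_bidirected_digraph (total_zero_divisor_graph R)"
proof -
  interpret pair_wf_digraph "total_zero_divisor_graph R"
    by standard (auto simp: total_zero_divisor_graph_def)
  show ?thesis
  proof
    fix e assume "e \<in> parcs (total_zero_divisor_graph R)"
    then show "fst e \<noteq> snd e"
      by (auto simp: total_zero_divisor_graph_def)
  next
    have carr: "x \<in> carrier R" if "x \<in> zero_divisors R" for x
      using that by (simp add: zero_divisors_def)
    show "symmetric (with_proj (total_zero_divisor_graph R))"
      unfolding symmetric_def
    proof (rule symI)
      fix u v assume "(u, v) \<in> arcs_ends (with_proj (total_zero_divisor_graph R))"
      then show "(v, u) \<in> arcs_ends (with_proj (total_zero_divisor_graph R))"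
        using m_comm[of u v] a_comm[of u v] carr
        by (simp add: total_zero_divisor_graph_def) metis
    qed
  qed
qed

end

theory Submission
  imports Defs
begin

text \<open>
  Let \<open>Z\<close> be the set of zero-divisors. In an Artinian ring a nonzero ideal contains a minimal one,
  say \<open>Rz\<close>, and \<open>Ann(z)\<close> is then a maximal ideal. Applied to the ideal generated by a witness
  \<open>y\<close> for \<open>u \<in> Z\<close>, this puts \<open>u\<close> into an associated prime that is a maximal ideal
  (\<open>zero_divisor_in_associated_maximal_ideal\<close>). So \<open>Z\<close> is a union of ideals \<open>P\<close>, each contained in
  \<open>Z\<close>, and the condition \<open>u \<oplus> v \<in> Z\<close> on an edge holds as soon as \<open>u\<close> and \<open>v\<close> lie in the same \<open>P\<close>.

  If every maximal associated prime \<open>P\<close> has a nonzero element \<open>s \<in> P \<inter> Ann(P)\<close>, then \<open>s\<close> is joined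
  to every other vertex in \<open>P\<close>. Two such hubs \<open>s\<close>, \<open>t\<close>, for \<open>P\<close> and \<open>Q\<close>, are equal or adjacent:
  if \<open>s \<otimes> t \<noteq> \<zero>\<close>, the proper ideal \<open>Ann(s \<otimes> t)\<close> would contain the maximal ideals \<open>P\<close> and \<open>Q\<close>
  and hence equal both, but then \<open>t \<in> P\<close> is killed by \<open>s\<close>; and \<open>s \<oplus> t \<in> Z\<close> because
  \<open>(s \<oplus> t) \<otimes> s = \<zero>\<close>. So all vertices are connected through hubs
  (\<open>connected_if_all_maximal_associated_primes_have_hubs\<close>).

  Conversely, let \<open>P = Ann(a)\<close> be an associated prime with \<open>P \<inter> Ann(P) = {\<zero>}\<close>. Then
  \<open>a \<notin> P\<close>, and the descending chain of the ideals \<open>Ra\<^sup>n\<close> yields an idempotent \<open>p \<in> P\<close> with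
  \<open>\<one> \<ominus> p \<in> Ra\<close>: the prime \<open>P\<close> is a direct factor of the ring, generated by \<open>p\<close>. If \<open>P = {\<zero>}\<close>,
  the ring is a domain and the graph has no vertices. Otherwise \<open>p\<close> is an isolated vertex, in the
  way \<open>(0, 1)\<close> is in the product of a field with a ring, while \<open>a\<close> is a second vertex
  (\<open>disconnected_if_associated_prime_without_hub\<close>).
\<close>

section \<open>Annihilators and associated primes\<close>

lemma (in cring) annihilator_singleton_ideal:
  assumes a: "a \<in> carrier R"
  shows "ideal (annihilator R {a}) R"
proof (rule idealI)
  show "subgroup (annihilator R {a}) (add_monoid R)"
    using a by (intro group.subgroupI[OF add.is_group])
      (auto simp: annihilator_def l_distr l_minus a_inv_def[symmetric])
  show "x \<otimes> b \<in> annihilator R {a}" "b \<otimes> x \<in> annihilator R {a}"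
    if "b \<in> annihilator R {a}" "x \<in> carrier R" for b x
    using that a by (auto simp: annihilator_def m_assoc m_comm[of b x])
qed (rule ring_axioms)

lemma (in cring) annihilator_singleton_proper:
  assumes "a \<in> carrier R" "a \<noteq> \<zero>"
  shows "annihilator R {a} \<noteq> carrier R"
proof
  assume "annihilator R {a} = carrier R"
  then have "\<one> \<in> annihilator R {a}" by simp
  with assms show False by (simp add: annihilator_def)
qed

lemma (in cring) associated_primeE:
  assumes "P \<in> associated_primes R"
  obtains a where "a \<in> carrier R" "a \<noteq> \<zero>" "P = annihilator R {a}" "primeideal P R"
proof -
  from assms obtain a where a: "a \<in> carrier R" "P = annihilator R {a}" and P: "primeideal P R"
    by (auto simp: associated_primes_def)
  have "a \<noteq> \<zero>"
  proof
    assume "a = \<zero>"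
    then have "P = carrier R" using a by (auto simp: annihilator_def)
    with primeideal.I_notcarr[OF P] show False by simp
  qed
  with a P that show ?thesis by blast
qed

lemma (in cring) associated_prime_subset_zero_divisors:
  assumes "P \<in> associated_primes R"
  shows "P \<subseteq> zero_divisors R"
  using assms by (auto elim!: associated_primeE simp: zero_divisors_def annihilator_def)

lemma (in cring) associated_maximal_ideal_is_maximal_associated_prime:
  assumes P: "P \<in> associated_primes R" "maximalideal P R"
  shows "P \<in> maximal_associated_primes R"
  unfolding maximal_associated_primes_def
proof (intro CollectI conjI ballI impI)
  fix Q assume Q: "Q \<in> associated_primes R" and "P \<subseteq> Q"
  from Q have pr: "primeideal Q R" by (simp add: associated_primes_def)
  then have "ideal Q R" by (rule primeideal.axioms)
  with \<open>P \<subseteq> Q\<close> show "Q = P"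
    using maximalideal.I_maximal[OF P(2), of Q] primeideal.I_notcarr[OF pr]
      additive_subgroup.a_subset[OF ideal.axioms(1)] by blast
qed (rule P(1))

section \<open>Consequences of the descending chain condition\<close>

lemma (in artinian_cring) wf_principal_ideal_inclusion:
  "wf {(x, y). x \<in> carrier R \<and> y \<in> carrier R \<and> PIdl x \<subset> PIdl y}"
  unfolding wf_iff_no_infinite_down_chain
proof
  assume "\<exists>f. \<forall>i. (f (Suc i), f i) \<in> {(x, y). x \<in> carrier R \<and> y \<in> carrier R \<and> PIdl x \<subset> PIdl y}"
  then obtain f
    where "\<forall>i. (f (Suc i), f i) \<in> {(x, y). x \<in> carrier R \<and> y \<in> carrier R \<and> PIdl x \<subset> PIdl y}" ..
  then have f: "f i \<in> carrier R" "PIdl (f (Suc i)) \<subset> PIdl (f i)" for i by simp_all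
  have "\<exists>m. \<forall>n\<ge>m. PIdl (f n) = PIdl (f m)"
    using f by (intro descending_chain) (auto intro: cgenideal_ideal)
  then obtain m where "\<forall>n\<ge>m. PIdl (f n) = PIdl (f m)" ..
  then have "PIdl (f (Suc m)) = PIdl (f m)" by (meson le_SucI order_refl)
  with f(2)[of m] show False by blast
qed

lemma (in artinian_cring) obtain_minimal_principal_ideal:
  assumes y: "y \<in> carrier R" "y \<noteq> \<zero>"
  obtains z where "z \<in> PIdl y" "z \<noteq> \<zero>" "\<And>w. w \<in> PIdl z \<Longrightarrow> w \<noteq> \<zero> \<Longrightarrow> z \<in> PIdl w"
proof -
  have sub: "PIdl w \<subseteq> PIdl x" if "w \<in> PIdl x" "x \<in> carrier R" for w x
    using that by (intro cgenideal_minimal cgenideal_ideal)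
  have carr: "w \<in> carrier R" if "w \<in> PIdl x" "x \<in> carrier R" for w x
    using that by (auto simp: cgenideal_def)
  have "y \<in> PIdl y - {\<zero>}" using y by (simp add: cgenideal_self)
  then obtain z where z: "z \<in> PIdl y - {\<zero>}"
    and min: "\<And>w. (w, z) \<in> {(x, y). x \<in> carrier R \<and> y \<in> carrier R \<and> PIdl x \<subset> PIdl y}
      \<Longrightarrow> w \<notin> PIdl y - {\<zero>}"
    by (rule wfE_min[OF wf_principal_ideal_inclusion]) blast
  have zc: "z \<in> carrier R" using z y carr by blast
  show thesis
  proof (rule that)
    fix w assume w: "w \<in> PIdl z" "w \<noteq> \<zero>"
    have wc: "w \<in> carrier R" using w zc carr by blast
    have "w \<in> PIdl y" using w z y sub by blast
    then have "\<not> PIdl w \<subset> PIdl z" using min[of w] w wc zc by auto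
    with sub[OF w(1) zc] have "PIdl w = PIdl z" by blast
    then show "z \<in> PIdl w" using cgenideal_self[OF zc] by simp
  qed (use z in auto)
qed

text \<open>
  The ideal \<open>Rz\<close> is a simple module isomorphic to \<open>R/Ann(z)\<close>: for \<open>s \<notin> Ann(z)\<close> the element
  \<open>s \<otimes> z\<close> generates \<open>z\<close> again, which makes \<open>s\<close> invertible modulo \<open>Ann(z)\<close>.
\<close>
lemma (in cring) annihilator_of_minimal_principal_ideal_maximal:
  assumes z: "z \<in> carrier R" "z \<noteq> \<zero>"
    and min: "\<And>w. w \<in> PIdl z \<Longrightarrow> w \<noteq> \<zero> \<Longrightarrow> z \<in> PIdl w"
  shows "maximalideal (annihilator R {z}) R"
proof (rule maximalidealI)
  show "ideal (annihilator R {z}) R" using z by (rule_tac annihilator_singleton_ideal)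
  show "carrier R \<noteq> annihilator R {z}" using annihilator_singleton_proper[OF z] by simp
next
  fix J assume J: "ideal J R" "annihilator R {z} \<subseteq> J" "J \<subseteq> carrier R"
  interpret J: ideal J R by (rule J)
  have "J = carrier R" if "J \<noteq> annihilator R {z}"
  proof -
    from that J obtain s where s: "s \<in> J" "s \<notin> annihilator R {z}" by blast
    have sc: "s \<in> carrier R" using s J by blast
    have "s \<otimes> z \<in> PIdl z" "s \<otimes> z \<noteq> \<zero>" using s sc by (auto simp: cgenideal_def annihilator_def)
    from min[OF this] obtain t where t: "t \<in> carrier R" "z = t \<otimes> (s \<otimes> z)"
      by (auto simp: cgenideal_def)
    have "(\<one> \<ominus> t \<otimes> s) \<otimes> z = z \<ominus> t \<otimes> (s \<otimes> z)"
      using t(1) sc z by (simp add: minus_eq l_distr l_minus m_assoc)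
    also have "\<dots> = z \<ominus> z" using t(2) by simp
    also have "\<dots> = \<zero>" using z by (simp add: minus_eq r_neg)
    finally have "\<one> \<ominus> t \<otimes> s \<in> J" using J t sc by (auto simp: annihilator_def)
    moreover have "t \<otimes> s \<in> J" using s t by (simp add: J.I_l_closed)
    ultimately have "(\<one> \<ominus> t \<otimes> s) \<oplus> t \<otimes> s \<in> J" by (rule J.a_closed)
    moreover have "(\<one> \<ominus> t \<otimes> s) \<oplus> t \<otimes> s = \<one>"
      using t(1) sc by (simp add: minus_eq a_assoc l_neg)
    ultimately show ?thesis by (simp add: J.one_imp_carrier)
  qed
  then show "J = annihilator R {z} \<or> J = carrier R" by blast
qed

text \<open>
  If \<open>y \<noteq> \<zero>\<close> and \<open>u \<otimes> y = \<zero>\<close>, then \<open>u\<close> kills every minimal ideal \<open>Rz\<close> inside \<open>Ry\<close>, and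
  \<open>Ann(z)\<close> is the required prime.
\<close>
lemma (in artinian_cring) zero_divisor_in_associated_maximal_ideal:
  assumes "u \<in> zero_divisors R"
  obtains P where "u \<in> P" "P \<in> maximal_associated_primes R" "maximalideal P R"
proof -
  from assms obtain y where u: "u \<in> carrier R"
    and y: "y \<in> carrier R" "y \<noteq> \<zero>" and uy: "u \<otimes> y = \<zero>"
    by (auto simp: zero_divisors_def)
  obtain z where z: "z \<in> PIdl y" "z \<noteq> \<zero>"
    and min: "\<And>w. w \<in> PIdl z \<Longrightarrow> w \<noteq> \<zero> \<Longrightarrow> z \<in> PIdl w"
    by (rule obtain_minimal_principal_ideal[OF y]) blast
  from z obtain r where r: "r \<in> carrier R" "z = r \<otimes> y" by (auto simp: cgenideal_def)
  then have zc: "z \<in> carrier R" using y by simp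
  have mx: "maximalideal (annihilator R {z}) R"
    by (rule annihilator_of_minimal_principal_ideal_maximal[OF zc z(2) min])
  then have "annihilator R {z} \<in> associated_primes R"
    using zc by (auto simp: associated_primes_def maximalideal_prime)
  then have "annihilator R {z} \<in> maximal_associated_primes R"
    using mx by (rule associated_maximal_ideal_is_maximal_associated_prime)
  moreover have "u \<in> annihilator R {z}"
    using u y uy r by (simp add: annihilator_def m_lcomm)
  ultimately show thesis using that mx by blast
qed

text \<open>
  The chain \<open>Ra\<^sup>n\<close> becomes stationary, so \<open>a\<^sup>m (\<one> \<ominus> r a) = \<zero> \<in> P\<close> for some \<open>m\<close> and \<open>r\<close>;
  primality lets the power of \<open>a\<close> be cancelled.
\<close>
lemma (in artinian_cring) invertible_modulo_prime:
  assumes P: "primeideal P R" and a: "a \<in> carrier R" "a \<notin> P"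
  obtains r where "r \<in> carrier R" "\<one> \<ominus> r \<otimes> a \<in> P"
proof -
  interpret P: primeideal P R by (rule P)
  have pow: "a [^] (n::nat) \<notin> P" for n
  proof (induction n)
    case 0
    show ?case using P.I_notcarr P.one_imp_carrier by auto
  next
    case (Suc n)
    then show ?case using P.I_prime[of "a [^] n" a] a by auto
  qed
  have "\<exists>m. \<forall>n\<ge>m. PIdl (a [^] (n::nat)) = PIdl (a [^] m)"
  proof (rule descending_chain)
    fix n :: nat
    show "ideal (PIdl (a [^] n)) R" using a by (simp add: cgenideal_ideal)
    have "a [^] Suc n \<in> PIdl (a [^] n)" using a by (auto simp: cgenideal_def m_comm)
    then show "PIdl (a [^] Suc n) \<subseteq> PIdl (a [^] n)"
      using a by (intro cgenideal_minimal cgenideal_ideal) auto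
  qed
  then obtain m where "PIdl (a [^] Suc m) = PIdl (a [^] m)" by (meson le_SucI order_refl)
  then have "a [^] m \<in> PIdl (a [^] Suc m)" using cgenideal_self[of "a [^] m"] a by simp
  then obtain r where r: "r \<in> carrier R" "a [^] m = r \<otimes> a [^] Suc m"
    by (auto simp: cgenideal_def)
  have "a [^] m \<otimes> (\<one> \<ominus> r \<otimes> a) = a [^] m \<ominus> r \<otimes> a [^] Suc m"
    using r(1) a by (simp add: minus_eq r_distr r_minus m_lcomm)
  also have "\<dots> = a [^] m \<ominus> a [^] m" using r(2) by simp
  also have "\<dots> = \<zero>" using a by (simp add: minus_eq r_neg)
  finally have "a [^] m \<otimes> (\<one> \<ominus> r \<otimes> a) \<in> P" by simp
  then have "\<one> \<ominus> r \<otimes> a \<in> P" using P.I_prime pow a r(1) by blast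
  with r(1) that show thesis by blast
qed

section \<open>Connectedness of the graph\<close>

text \<open>
  The arc relation is already symmetric, so the symmetric closure that the definition of
  connectedness takes can be dropped, and connectedness is reachability along arcs.
\<close>
lemma (in cring) connected_total_zero_divisor_graph_iff:
  "Digraph_Component.connected (with_proj (total_zero_divisor_graph R)) \<longleftrightarrow>
    zero_divisors R - {\<zero>} \<noteq> {} \<and>
    (\<forall>u \<in> zero_divisors R - {\<zero>}. \<forall>v \<in> zero_divisors R - {\<zero>}.
      (u, v) \<in> rtrancl_on (zero_divisors R - {\<zero>}) (parcs (total_zero_divisor_graph R)))"
proof -
  interpret pair_bidirected_digraph "total_zero_divisor_graph R"
    by (rule total_zero_divisor_graph_bidirected)
  have "sym (parcs (total_zero_divisor_graph R))"
    using sym_arcs by (simp add: symmetric_def)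
  then have "(parcs (total_zero_divisor_graph R))\<^sup>s = parcs (total_zero_divisor_graph R)"
    by (auto simp: symcl_def dest: symD)
  then show ?thesis
    unfolding connected_conv by (simp add: total_zero_divisor_graph_def)
qed

text \<open>The witness for \<open>s \<oplus> t\<close> being a zero-divisor is \<open>s\<close> itself.\<close>
lemma (in cring) zero_divisor_sumI:
  assumes "s \<in> carrier R" "t \<in> carrier R" "s \<noteq> \<zero>" "s \<otimes> s = \<zero>" "s \<otimes> t = \<zero>"
  shows "s \<oplus> t \<in> zero_divisors R"
proof -
  have "(s \<oplus> t) \<otimes> s = \<zero>" using assms by (simp add: l_distr m_comm[of t s])
  with assms show ?thesis by (auto simp: zero_divisors_def)
qed

text \<open>
  A hub of a maximal ideal \<open>P\<close> is a nonzero element of \<open>P\<close> killed by all of \<open>P\<close>; in particular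
  its square is zero. Any two vertices \<open>u\<close> and \<open>v\<close> are linked by a walk \<open>u, s, t, v\<close>, possibly with
  repetitions, where \<open>s\<close> and \<open>t\<close> are hubs of maximal ideals containing \<open>u\<close> and \<open>v\<close>.
\<close>
lemma (in artinian_cring) connected_if_all_maximal_associated_primes_have_hubs:
  assumes ne: "\<one> \<noteq> \<zero>"
    and hubs: "\<And>P. P \<in> maximal_associated_primes R \<Longrightarrow> P \<inter> annihilator R P \<noteq> {\<zero>}"
  shows "Digraph_Component.connected (with_proj (total_zero_divisor_graph R))"
proof -
  let ?V = "zero_divisors R - {\<zero>}" and ?E = "parcs (total_zero_divisor_graph R)"
  define hub where "hub s P \<longleftrightarrow> maximalideal P R \<and> s \<in> P \<inter> annihilator R P - {\<zero>}" for s P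
  have hub_carrier: "s \<in> carrier R" "s \<noteq> \<zero>" "s \<otimes> s = \<zero>" if "hub s P" for s P
    using that by (auto simp: hub_def annihilator_def)
  have hub_vertex: "s \<in> ?V" if "hub s P" for s P
    using hub_carrier[OF that] by (auto simp: zero_divisors_def)
  have obtain_hub: "\<exists>P s. u \<in> P \<and> hub s P" if u: "u \<in> zero_divisors R" for u
  proof -
    obtain P where P: "u \<in> P" "P \<in> maximal_associated_primes R" "maximalideal P R"
      by (rule zero_divisor_in_associated_maximal_ideal[OF u])
    interpret P: maximalideal P R by (rule P)
    have "\<zero> \<in> P \<inter> annihilator R P" using P.a_subset by (auto simp: annihilator_def)
    with hubs[OF P(2)] obtain s where "s \<in> P \<inter> annihilator R P - {\<zero>}" by blast
    with P show ?thesis by (auto simp: hub_def)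
  qed
  \<comment> \<open>Equality is possible: the vertex may itself be the hub chosen for its ideal.\<close>
  have hub_near: "s = u \<or> (s, u) \<in> ?E \<and> (u, s) \<in> ?E" if "hub s P" "u \<in> ?V" "s \<otimes> u = \<zero>" for s P u
  proof -
    have u: "u \<in> carrier R" using that by (auto simp: zero_divisors_def)
    have "s \<oplus> u \<in> zero_divisors R"
      using hub_carrier[OF that(1)] u that by (intro zero_divisor_sumI)
    then show ?thesis
      using that(2,3) hub_vertex[OF that(1)] m_comm[of s u] a_comm[of s u] hub_carrier(1)[OF that(1)] u
      by (simp add: total_zero_divisor_graph_def) metis
  qed
  have hubs_orthogonal: "s \<otimes> t = \<zero>" if s: "hub s P" and t: "hub t Q" for s t P Q
  proof (rule ccontr)
    assume st: "s \<otimes> t \<noteq> \<zero>"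
    interpret P: maximalideal P R using s by (simp add: hub_def)
    interpret Q: maximalideal Q R using t by (simp add: hub_def)
    note c = hub_carrier(1)[OF s] hub_carrier(1)[OF t]
    let ?A = "annihilator R {s \<otimes> t}"
    have A: "ideal ?A R" "?A \<noteq> carrier R" "?A \<subseteq> carrier R"
      using c st by (simp_all add: annihilator_singleton_ideal annihilator_singleton_proper)
        (auto simp: annihilator_def)
    have "P \<subseteq> ?A"
    proof
      fix x assume x: "x \<in> P"
      then have "s \<otimes> x = \<zero>" using s by (simp add: hub_def annihilator_def)
      then show "x \<in> ?A" using x c P.a_subset[THEN subsetD, OF x]
        by (simp add: annihilator_def m_assoc[symmetric] m_comm[of x s])
    qed
    moreover have "Q \<subseteq> ?A"
    proof
      fix x assume x: "x \<in> Q"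
      then have "t \<otimes> x = \<zero>" using t by (simp add: hub_def annihilator_def)
      moreover have "x \<in> carrier R" using x Q.a_subset by blast
      ultimately show "x \<in> ?A" using c by (simp add: annihilator_def m_lcomm m_comm[of x t])
    qed
    ultimately have "?A = P" "?A = Q" using P.I_maximal Q.I_maximal A by blast+
    then have "t \<in> P" using t by (simp add: hub_def)
    with s st show False by (simp add: hub_def annihilator_def)
  qed
  have step: "(x, y) \<in> rtrancl_on ?V ?E" if "x = y \<or> (x, y) \<in> ?E" "x \<in> ?V" "y \<in> ?V" for x y
    using that by (auto intro: rtrancl_on_into_rtrancl_on)
  have path: "(u, v) \<in> rtrancl_on ?V ?E" if u: "u \<in> ?V" and v: "v \<in> ?V" for u v
  proof -
    obtain P s where s: "u \<in> P" "hub s P" using obtain_hub u by blast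
    obtain Q t where t: "v \<in> Q" "hub t Q" using obtain_hub v by blast
    have "s \<otimes> u = \<zero>" "t \<otimes> v = \<zero>" using s t by (auto simp: hub_def annihilator_def)
    then have "(u, s) \<in> rtrancl_on ?V ?E" "(s, t) \<in> rtrancl_on ?V ?E" "(t, v) \<in> rtrancl_on ?V ?E"
      using hub_near[OF s(2) u] hub_near[OF t(2) v]
        hub_near[OF s(2) hub_vertex[OF t(2)] hubs_orthogonal[OF s(2) t(2)]]
      by (auto intro!: step u v hub_vertex[OF s(2)] hub_vertex[OF t(2)])
    then show ?thesis by (meson rtrancl_on_trans)
  qed
  have "?V \<noteq> {}" using obtain_hub[OF zero_in_zero_divisors[OF ne]] hub_vertex by blast
  with path show ?thesis by (simp add: connected_total_zero_divisor_graph_iff)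
qed

text \<open>
  Write \<open>P = Ann(a)\<close> and \<open>p = \<one> \<ominus> r \<otimes> a \<in> P\<close>. Multiplication by \<open>p\<close> is the identity on \<open>P\<close>, as
  \<open>a\<close> kills \<open>P\<close>. A neighbour \<open>v\<close> of \<open>p\<close> would satisfy \<open>p \<otimes> v = \<zero>\<close>, hence \<open>v \<notin> P\<close>, and some \<open>y \<noteq> \<zero>\<close>
  would be killed by \<open>p \<oplus> v\<close>, hence by \<open>p\<close> and by \<open>v\<close> separately. Primality then puts \<open>y\<close> into
  \<open>P\<close>, where \<open>p\<close> cannot kill it.
\<close>
lemma (in artinian_cring) disconnected_if_associated_prime_without_hub:
  assumes P: "P \<in> associated_primes R" and PA: "P \<inter> annihilator R P = {\<zero>}"
  shows "\<not> Digraph_Component.connected (with_proj (total_zero_divisor_graph R))"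
proof
  let ?V = "zero_divisors R - {\<zero>}" and ?E = "parcs (total_zero_divisor_graph R)"
  assume con: "Digraph_Component.connected (with_proj (total_zero_divisor_graph R))"
  obtain a where a: "a \<in> carrier R" "a \<noteq> \<zero>" and Pa: "P = annihilator R {a}"
    and pr: "primeideal P R" by (rule associated_primeE[OF P])
  interpret P: primeideal P R by (rule pr)
  have Pc: "x \<in> carrier R" if "x \<in> P" for x using that P.a_subset by blast
  have xa: "x \<otimes> a = \<zero>" "a \<otimes> x = \<zero>" if "x \<in> P" for x
    using that a m_comm[OF a(1) Pc[OF that]] unfolding Pa annihilator_def by auto
  have "a \<in> annihilator R P" using xa a by (simp add: annihilator_def)
  with PA a have aP: "a \<notin> P" by blast
  obtain r where r: "r \<in> carrier R" "\<one> \<ominus> r \<otimes> a \<in> P"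
    by (rule invertible_modulo_prime[OF pr a(1) aP])
  \<comment> \<open>The complementary idempotent \<open>r \<otimes> a\<close> splits off the ring factor isomorphic to \<open>R/P\<close>.\<close>
  define p where "p = \<one> \<ominus> r \<otimes> a"
  have pP: "p \<in> P" using r by (simp add: p_def)
  note pc = Pc[OF pP]
  have decomp: "x = x \<otimes> p \<oplus> r \<otimes> (a \<otimes> x)" if "x \<in> carrier R" for x
  proof -
    have "\<one> = p \<oplus> r \<otimes> a" using a r by (simp add: p_def minus_eq a_assoc l_neg)
    then have "x \<otimes> \<one> = x \<otimes> (p \<oplus> r \<otimes> a)" by simp
    then show ?thesis using that a r pc by (simp add: r_distr m_lcomm[of x r a] m_comm[of x a])
  qed
  have p_unit: "x \<otimes> p = x" if "x \<in> P" for x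
    using decomp[OF Pc[OF that]] xa[OF that] r Pc[OF that] pc by simp
  show False
  proof (cases "p = \<zero>")
    case True
    then have "P = {\<zero>}" using p_unit Pc pP by fastforce
    then have "zero_divisors R \<subseteq> {\<zero>}" using P.I_prime by (fastforce simp: zero_divisors_def)
    then show False using con by (auto simp: connected_total_zero_divisor_graph_iff)
  next
    case False
    have "a \<in> ?V" "p \<in> ?V" using a False pc xa[OF pP] by (auto simp: zero_divisors_def)
    then have "(p, a) \<in> rtrancl_on ?V ?E"
      using con by (simp add: connected_total_zero_divisor_graph_iff)
    moreover have "p \<noteq> a" using pP aP by blast
    ultimately obtain v where "(p, v) \<in> ?E" by (blast elim: converse_rtrancl_on_cases)
    then have v: "v \<in> carrier R" "v \<noteq> \<zero>" "p \<otimes> v = \<zero>" and "p \<oplus> v \<in> zero_divisors R"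
      by (auto simp: total_zero_divisor_graph_def zero_divisors_def)
    then obtain y where y: "y \<in> carrier R" "y \<noteq> \<zero>" "(p \<oplus> v) \<otimes> y = \<zero>"
      by (auto simp: zero_divisors_def)
    have vP: "v \<notin> P" using p_unit[of v] v m_comm[OF v(1) pc] by auto
    \<comment> \<open>As \<open>p\<close> is idempotent and kills \<open>v\<close>, multiplying by \<open>p\<close> separates the two summands.\<close>
    have "p \<otimes> ((p \<oplus> v) \<otimes> y) = (p \<otimes> p \<oplus> p \<otimes> v) \<otimes> y"
      using pc v(1) y(1) by (simp add: r_distr m_assoc[symmetric])
    then have py: "p \<otimes> y = \<zero>" using y v(3) p_unit[OF pP] pc by simp
    then have "v \<otimes> y = \<zero>" using y v(1) pc by (simp add: l_distr)
    then have "y \<in> P" using P.I_prime[of v y] v(1) y(1) vP by simp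
    then have "y = \<zero>" using p_unit[of y] py m_comm[OF y(1) pc] by simp
    with y show False by simp
  qed
qed

theorem theorem3p1:
  fixes R :: "('a, 'b) ring_scheme" (structure)
  assumes "artinian_cring R" and "\<one> \<noteq> \<zero>"
  shows "Digraph_Component.connected (with_proj (total_zero_divisor_graph R)) \<longleftrightarrow>
    (\<forall>P \<in> maximal_associated_primes R. P \<inter> annihilator R P \<noteq> {\<zero>})"
proof -
  interpret artinian_cring R by fact
  show ?thesis
    using connected_if_all_maximal_associated_primes_have_hubs[OF assms(2)]
      disconnected_if_associated_prime_without_hub
    by (auto simp: maximal_associated_primes_def)
qed

end
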